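(* Let $\mathbb{K}\in\{\mathbb{R},\mathbb{C}\}$, let $V$ be a finite-dimensional $\mathbb{K}$-vector space, let $\mathfrak{r}\subset\mathbb{K}[\mathcal{S}_3]$ be a minimal right ideal belonging to the partition $(2\,1)\vdash 3$, let $\mathcal{T}_{\mathfrak{r}}$ be the symmetry class of tensors in $\mathcal{T}_3V$ defined by $\mathfrak{r}$, and let $y_t$, $y_{t'}$ be the Young symmetrizers of the Young tableaux $t$ with rows $(1,3),(2,4)$ and $t'$ with rows $(1,3,5),(2,4)$. If $U\in\mathcal{T}_{\mathfrak{r}}$, $S\in\mathcal{S}^2(V)$, $A\in\Lambda^2(V)$ and $w\in\mathcal{T}_1V$, then $$y_t^{\ast}(U\otimes w)=y_t^{\ast}(w\otimes U),\qquad y_{t'}^{\ast}(U\otimes S)=y_{t'}^{\ast}(S\otimes U),\qquad y_{t'}^{\ast}(U\otimes A)=-\,y_{t'}^{\ast}(A\otimes U).$$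
   Context: $\mathcal{T}_rV$ is the space of $r$-times covariant tensors on $V$; $\mathcal{S}^2(V)$, $\Lambda^2(V)\subset\mathcal{T}_2V$ are the symmetric, resp. alternating, 2-forms. A group ring element $a=\sum_{p\in\mathcal{S}_r}a(p)\,p\in\mathbb{K}[\mathcal{S}_r]$ acts on $T\in\mathcal{T}_rV$ by $(aT)(v_1,\dots,v_r)=\sum_p a(p)\,T(v_{p(1)},\dots,v_{p(r)})$. Products of permutations are $(p\circ q)(i)=p(q(i))$, and $a^{\ast}:=\sum_p a(p)\,p^{-1}$. The Young symmetrizer of a Young tableau $t$ is $y_t=\sum_{p\in\mathcal{H}_t}\sum_{q\in\mathcal{V}_t}\mathrm{sign}(q)\,p\circ q$, where $\mathcal{H}_t$, $\mathcal{V}_t$ are the groups of permutations that permute numbers only within the rows, resp. columns, of $t$. The symmetry class of a right ideal $\mathfrak{r}\subseteq\mathbb{K}[\mathcal{S}_r]$ is $\mathcal{T}_{\mathfrak{r}}=\{aT\,|\,a\in\mathfrak{r},\,T\in\mathcal{T}_rV\}$. A minimal right ideal belongs to $\lambda\vdash r$ if it lies in the minimal two-sided ideal of $\mathbb{K}[\mathcal{S}_r]$ corresponding to $\lambda$, i.e. the one containing the Young symmetrizers of all tableaux of frame $\lambda$. *)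

theory Defs
  imports "HOL-Analysis.Analysis" "HOL-Algebra.Ideal" "HOL-Combinatorics.Permutations"
begin

section \<open>The group ring of a symmetric group\<close>

text \<open>The symmetric group on \<open>{1..r}\<close> consists of the functions \<open>p :: nat \<Rightarrow> nat\<close> with
  \<open>p permutes {1..r}\<close>, and the group operation is \<open>p \<circ> q\<close>.\<close>

definition sym_perms :: "nat \<Rightarrow> (nat \<Rightarrow> nat) set" where
  "sym_perms r = {p. p permutes {1..r}}"

text \<open>An element of the group ring is its coefficient function, which is required to vanish off
  \<^term>\<open>sym_perms r\<close>, so that equality of group ring elements is equality of functions.\<close>

definition group_ring :: "nat \<Rightarrow> ((nat \<Rightarrow> nat) \<Rightarrow> 'k::comm_ring_1) ring" where
  "group_ring r = \<lparr>
     carrier = {a. \<forall>s. s \<notin> sym_perms r \<longrightarrow> a s = 0},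
     monoid.mult = (\<lambda>a b s. \<Sum>p\<in>sym_perms r. \<Sum>q\<in>sym_perms r. if p \<circ> q = s then a p * b q else 0),
     one = (\<lambda>s. if s = id then 1 else 0),
     zero = (\<lambda>s. 0),
     add = (\<lambda>a b s. a s + b s)\<rparr>"

lemma finite_sym_perms [simp]: "finite (sym_perms r)"
  by (simp add: sym_perms_def finite_permutations)

lemma sym_perms_comp: "p \<in> sym_perms r \<Longrightarrow> q \<in> sym_perms r \<Longrightarrow> p \<circ> q \<in> sym_perms r"
  by (simp add: sym_perms_def permutes_compose)

lemma id_sym_perms [simp]: "id \<in> sym_perms r"
  by (simp add: sym_perms_def permutes_id)

lemma group_ring_is_ring: "ring (group_ring r :: ((nat \<Rightarrow> nat) \<Rightarrow> 'k::comm_ring_1) ring)"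
proof (rule ringI)
  let ?R = "group_ring r :: ((nat \<Rightarrow> nat) \<Rightarrow> 'k) ring"
  let ?S = "sym_perms r"
  have carr: "carrier ?R = {a. \<forall>s. s \<notin> ?S \<longrightarrow> a s = 0}"
    and mult: "\<And>a b. a \<otimes>\<^bsub>?R\<^esub> b = (\<lambda>s. \<Sum>p\<in>?S. \<Sum>q\<in>?S. if p \<circ> q = s then a p * b q else 0)"
    and one: "\<one>\<^bsub>?R\<^esub> = (\<lambda>s. if s = id then 1 else 0)"
    and zero: "\<zero>\<^bsub>?R\<^esub> = (\<lambda>s. 0)"
    and add: "\<And>a b. a \<oplus>\<^bsub>?R\<^esub> b = (\<lambda>s. a s + b s)"
    by (simp_all add: group_ring_def)
  show "abelian_group ?R"
  proof (rule abelian_groupI)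
    fix x assume "x \<in> carrier ?R"
    then show "\<exists>y\<in>carrier ?R. y \<oplus>\<^bsub>?R\<^esub> x = \<zero>\<^bsub>?R\<^esub>"
      by (intro bexI[of _ "\<lambda>s. - x s"]) (simp_all add: carr add zero)
  qed (auto simp: carr add zero algebra_simps)
  show "Group.monoid ?R"
  proof (rule monoidI)
    fix a b assume "a \<in> carrier ?R" "b \<in> carrier ?R"
    have "(\<Sum>p\<in>?S. \<Sum>q\<in>?S. if p \<circ> q = s then a p * b q else 0) = 0" if "s \<notin> ?S" for s
      using that by (intro sum.neutral ballI) (auto dest: sym_perms_comp)
    then show "a \<otimes>\<^bsub>?R\<^esub> b \<in> carrier ?R" by (simp add: carr mult)
  next
    show "\<one>\<^bsub>?R\<^esub> \<in> carrier ?R" by (auto simp: carr one)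
  next
    fix a b c
    have l: "(a \<otimes>\<^bsub>?R\<^esub> b \<otimes>\<^bsub>?R\<^esub> c) s =
      (\<Sum>p\<in>?S. \<Sum>u\<in>?S. \<Sum>q\<in>?S. if p \<circ> u \<circ> q = s then a p * b u * c q else 0)" for s
    proof -
      have "(a \<otimes>\<^bsub>?R\<^esub> b \<otimes>\<^bsub>?R\<^esub> c) s = (\<Sum>x\<in>?S. \<Sum>q\<in>?S. \<Sum>p\<in>?S. \<Sum>u\<in>?S.
          if p \<circ> u = x then (if x \<circ> q = s then a p * b u * c q else 0) else 0)"
        by (simp add: mult sum_distrib_right if_distrib[of "\<lambda>z. z * _"] cong: if_cong)
          (intro sum.cong refl, auto intro!: sum.cong simp: sum.neutral)
      also have "\<dots> = (\<Sum>q\<in>?S. \<Sum>p\<in>?S. \<Sum>u\<in>?S. \<Sum>x\<in>?S.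
          if p \<circ> u = x then (if x \<circ> q = s then a p * b u * c q else 0) else 0)"
        by (rule trans[OF sum.swap], rule sum.cong[OF refl], rule trans[OF sum.swap],
            rule sum.cong[OF refl], rule sum.swap)
      also have "\<dots> = (\<Sum>q\<in>?S. \<Sum>p\<in>?S. \<Sum>u\<in>?S. if p \<circ> u \<circ> q = s then a p * b u * c q else 0)"
        by (intro sum.cong refl) (simp add: sym_perms_comp)
      also have "\<dots> = (\<Sum>p\<in>?S. \<Sum>u\<in>?S. \<Sum>q\<in>?S. if p \<circ> u \<circ> q = s then a p * b u * c q else 0)"
        by (rule trans[OF sum.swap], rule sum.cong[OF refl], rule sum.swap)
      finally show ?thesis .
    qed
    have r: "(a \<otimes>\<^bsub>?R\<^esub> (b \<otimes>\<^bsub>?R\<^esub> c)) s =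
      (\<Sum>p\<in>?S. \<Sum>u\<in>?S. \<Sum>q\<in>?S. if p \<circ> u \<circ> q = s then a p * b u * c q else 0)" for s
    proof -
      have "(a \<otimes>\<^bsub>?R\<^esub> (b \<otimes>\<^bsub>?R\<^esub> c)) s = (\<Sum>p\<in>?S. \<Sum>x\<in>?S. \<Sum>u\<in>?S. \<Sum>q\<in>?S.
          if u \<circ> q = x then (if p \<circ> x = s then a p * b u * c q else 0) else 0)"
        by (simp add: mult sum_distrib_left if_distrib[of "\<lambda>z. _ * z"] mult.assoc cong: if_cong)
          (intro sum.cong refl, auto intro!: sum.cong simp: sum.neutral)
      also have "\<dots> = (\<Sum>p\<in>?S. \<Sum>u\<in>?S. \<Sum>q\<in>?S. \<Sum>x\<in>?S.
          if u \<circ> q = x then (if p \<circ> x = s then a p * b u * c q else 0) else 0)"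
        by (rule sum.cong[OF refl], rule trans[OF sum.swap], rule sum.cong[OF refl], rule sum.swap)
      also have "\<dots> = (\<Sum>p\<in>?S. \<Sum>u\<in>?S. \<Sum>q\<in>?S. if p \<circ> u \<circ> q = s then a p * b u * c q else 0)"
        by (intro sum.cong refl) (simp add: sym_perms_comp o_assoc)
      finally show ?thesis .
    qed
    show "a \<otimes>\<^bsub>?R\<^esub> b \<otimes>\<^bsub>?R\<^esub> c = a \<otimes>\<^bsub>?R\<^esub> (b \<otimes>\<^bsub>?R\<^esub> c)"
      by (rule ext) (simp only: l r)
  next
    fix a assume a: "a \<in> carrier ?R"
    have "(\<Sum>p\<in>?S. \<Sum>q\<in>?S. if p \<circ> q = s then (if p = id then 1 else 0) * a q else 0) = a s" for s
    proof -
      have "(\<Sum>p\<in>?S. \<Sum>q\<in>?S. if p \<circ> q = s then (if p = id then 1 else 0) * a q else 0)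
        = (\<Sum>p\<in>?S. if p = id then (\<Sum>q\<in>?S. if q = s then a q else 0) else 0)"
        by (intro sum.cong refl) (auto intro!: sum.cong sum.neutral)
      also have "\<dots> = a s" using a by (auto simp: carr)
      finally show ?thesis .
    qed
    then show "\<one>\<^bsub>?R\<^esub> \<otimes>\<^bsub>?R\<^esub> a = a" by (simp add: mult one)
    have "(\<Sum>p\<in>?S. \<Sum>q\<in>?S. if p \<circ> q = s then a p * (if q = id then 1 else 0) else 0) = a s" for s
    proof -
      have "(\<Sum>p\<in>?S. \<Sum>q\<in>?S. if p \<circ> q = s then a p * (if q = id then 1 else 0) else 0)
        = (\<Sum>p\<in>?S. \<Sum>q\<in>?S. if q = id then (if p = s then a p else 0) else 0)"
        by (intro sum.cong refl) auto
      also have "\<dots> = a s" using a by (auto simp: carr)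
      finally show ?thesis .
    qed
    then show "a \<otimes>\<^bsub>?R\<^esub> \<one>\<^bsub>?R\<^esub> = a" by (simp add: mult one)
  qed
  fix a b c
  show "(a \<oplus>\<^bsub>?R\<^esub> b) \<otimes>\<^bsub>?R\<^esub> c = a \<otimes>\<^bsub>?R\<^esub> c \<oplus>\<^bsub>?R\<^esub> b \<otimes>\<^bsub>?R\<^esub> c"
    by (rule ext) (auto simp: mult add sum.distrib[symmetric] algebra_simps intro!: sum.cong)
  show "c \<otimes>\<^bsub>?R\<^esub> (a \<oplus>\<^bsub>?R\<^esub> b) = c \<otimes>\<^bsub>?R\<^esub> a \<oplus>\<^bsub>?R\<^esub> c \<otimes>\<^bsub>?R\<^esub> b"
    by (rule ext) (auto simp: mult add sum.distrib[symmetric] algebra_simps intro!: sum.cong)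
qed

text \<open>\<^term>\<open>inv_into UNIV p\<close> is the inverse function of \<open>p\<close>; the notation \<open>inv\<close> is taken by HOL-Algebra.\<close>

definition star :: "nat \<Rightarrow> ((nat \<Rightarrow> nat) \<Rightarrow> 'k::comm_ring_1) \<Rightarrow> (nat \<Rightarrow> nat) \<Rightarrow> 'k" where
  "star r a = (\<lambda>s. \<Sum>p\<in>sym_perms r. if inv_into UNIV p = s then a p else 0)"

definition right_ideal :: "'a set \<Rightarrow> ('a, 'm) ring_scheme \<Rightarrow> bool" where
  "right_ideal I R \<longleftrightarrow> ring R \<and> additive_subgroup I R \<and>
     (\<forall>a\<in>I. \<forall>x\<in>carrier R. a \<otimes>\<^bsub>R\<^esub> x \<in> I)"

definition minimal_right_ideal :: "'a set \<Rightarrow> ('a, 'm) ring_scheme \<Rightarrow> bool" where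
  "minimal_right_ideal I R \<longleftrightarrow> right_ideal I R \<and> I \<noteq> {\<zero>\<^bsub>R\<^esub>} \<and>
     (\<forall>J. right_ideal J R \<and> J \<subseteq> I \<longrightarrow> J = {\<zero>\<^bsub>R\<^esub>} \<or> J = I)"

definition minimal_ideal :: "'a set \<Rightarrow> ('a, 'm) ring_scheme \<Rightarrow> bool" where
  "minimal_ideal I R \<longleftrightarrow> ideal I R \<and> I \<noteq> {\<zero>\<^bsub>R\<^esub>} \<and>
     (\<forall>J. ideal J R \<and> J \<subseteq> I \<longrightarrow> J = {\<zero>\<^bsub>R\<^esub>} \<or> J = I)"

section \<open>Young tableaux and Young symmetrizers\<close>

text \<open>A tableau is the list of its rows; a partition is the weakly decreasing list of its positive
  parts.\<close>

definition young_tableau :: "nat list \<Rightarrow> nat list list \<Rightarrow> bool" where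
  "young_tableau lam t \<longleftrightarrow> map length t = lam \<and> distinct (concat t) \<and> set (concat t) = {1..sum_list lam}"

definition tableau_size :: "nat list list \<Rightarrow> nat" where
  "tableau_size t = length (concat t)"

definition tableau_column :: "nat list list \<Rightarrow> nat \<Rightarrow> nat set" where
  "tableau_column t j = {row ! j | row. row \<in> set t \<and> j < length row}"

definition horizontal_perms :: "nat list list \<Rightarrow> (nat \<Rightarrow> nat) set" where
  "horizontal_perms t = {p \<in> sym_perms (tableau_size t). \<forall>row\<in>set t. p ` set row = set row}"

definition vertical_perms :: "nat list list \<Rightarrow> (nat \<Rightarrow> nat) set" where
  "vertical_perms t =
     {q \<in> sym_perms (tableau_size t). \<forall>j. q ` tableau_column t j = tableau_column t j}"

definition young_symmetrizer :: "nat list list \<Rightarrow> (nat \<Rightarrow> nat) \<Rightarrow> 'k::comm_ring_1" where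
  "young_symmetrizer t = (\<lambda>s. \<Sum>p\<in>horizontal_perms t. \<Sum>q\<in>vertical_perms t.
     if p \<circ> q = s then of_int (sign q) else 0)"

definition belongs_to_partition ::
    "((nat \<Rightarrow> nat) \<Rightarrow> 'k::comm_ring_1) set \<Rightarrow> nat list \<Rightarrow> bool" where
  "belongs_to_partition J lam \<longleftrightarrow> (\<exists>I. minimal_ideal I (group_ring (sum_list lam)) \<and>
     (\<forall>t. young_tableau lam t \<longrightarrow> young_symmetrizer t \<in> I) \<and> J \<subseteq> I)"

section \<open>Covariant tensors\<close>

text \<open>The argument tuple \<open>(v\<^sub>1, \<dots>, v\<^sub>r)\<close> of a tensor is a function \<open>v :: nat \<Rightarrow> 'v\<close>. A tensor may
  only look at the entries \<open>v 1, \<dots>, v r\<close>, so that equality of tensors is equality of functions.\<close>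

definition covariant_tensors ::
    "('k::field \<Rightarrow> 'v::ab_group_add \<Rightarrow> 'v) \<Rightarrow> nat \<Rightarrow> ((nat \<Rightarrow> 'v) \<Rightarrow> 'k) set" where
  "covariant_tensors scl r = {T.
     (\<forall>v v'. (\<forall>i\<in>{1..r}. v i = v' i) \<longrightarrow> T v = T v') \<and>
     (\<forall>v. \<forall>i\<in>{1..r}. Vector_Spaces.linear scl (*) (\<lambda>x. T (v(i := x))))}"

definition symmetric_2_forms ::
    "('k::field \<Rightarrow> 'v::ab_group_add \<Rightarrow> 'v) \<Rightarrow> ((nat \<Rightarrow> 'v) \<Rightarrow> 'k) set" where
  "symmetric_2_forms scl =
     {T \<in> covariant_tensors scl 2. \<forall>v. T (v \<circ> Transposition.transpose 1 2) = T v}"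

definition alternating_2_forms ::
    "('k::field \<Rightarrow> 'v::ab_group_add \<Rightarrow> 'v) \<Rightarrow> ((nat \<Rightarrow> 'v) \<Rightarrow> 'k) set" where
  "alternating_2_forms scl =
     {T \<in> covariant_tensors scl 2. \<forall>v. T (v \<circ> Transposition.transpose 1 2) = - T v}"

text \<open>The first argument is the order of the left factor.\<close>

definition tensor_product ::
    "nat \<Rightarrow> ((nat \<Rightarrow> 'v) \<Rightarrow> 'k::comm_ring_1) \<Rightarrow> ((nat \<Rightarrow> 'v) \<Rightarrow> 'k) \<Rightarrow> (nat \<Rightarrow> 'v) \<Rightarrow> 'k" where
  "tensor_product r S T = (\<lambda>v. S v * T (\<lambda>i. v (r + i)))"

definition act ::
    "nat \<Rightarrow> ((nat \<Rightarrow> nat) \<Rightarrow> 'k::comm_ring_1) \<Rightarrow> ((nat \<Rightarrow> 'v) \<Rightarrow> 'k) \<Rightarrow> (nat \<Rightarrow> 'v) \<Rightarrow> 'k" where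
  "act r a T = (\<lambda>v. \<Sum>p\<in>sym_perms r. a p * T (\<lambda>i. v (p i)))"

definition symmetry_class ::
    "('k::field \<Rightarrow> 'v::ab_group_add \<Rightarrow> 'v) \<Rightarrow> nat \<Rightarrow> ((nat \<Rightarrow> nat) \<Rightarrow> 'k) set
      \<Rightarrow> ((nat \<Rightarrow> 'v) \<Rightarrow> 'k) set" where
  "symmetry_class scl r J = {act r a T | a T. a \<in> J \<and> T \<in> covariant_tensors scl r}"

section \<open>The ground field\<close>

text \<open>The sort \<open>{real_normed_field, euclidean_space}\<close> renders a ground field that is
  \<open>\<real>\<close> or \<open>\<complex>\<close>: both are instances, and there are no others up to isomorphism, because a
  finite-dimensional commutative real division algebra is isomorphic to \<open>\<real>\<close> or \<open>\<complex>\<close>.\<close>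

end

theory Submission
  imports Defs
begin

text \<open>Write \<open>y\<^sub>t\<^sup>* T\<close> as the alternating sum over the column group \<open>\<V>\<close> of the symmetrization
  of \<open>T\<close> over the row group \<open>\<H>\<close>. Permuting the arguments of \<open>T\<close> by \<open>h \<in> \<H>\<close> does not change
  \<open>y\<^sub>t\<^sup>* T\<close>, and permuting them by some \<open>q \<in> \<V>\<close> that normalizes \<open>\<H>\<close> multiplies it by
  \<open>sign q\<close>. In each of the three identities one tensor arises from the other by such permutations:
  for \<open>S\<close> and \<open>A\<close> the row permutation \<open>(1 5 3)(2 4)\<close> turns \<open>S \<otimes> U\<close> into \<open>U \<otimes> S\<close> with the two
  arguments of \<open>S\<close> exchanged, and for \<open>w\<close> one uses the row permutation \<open>(1 3)\<close> together with the
  even column permutation \<open>(1 2)(3 4)\<close>, which exchanges the two rows.\<close>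

section \<open>Row and column permutations as groups\<close>

lemma inv_into_comp_permutes:
  "p permutes A \<Longrightarrow> q permutes A \<Longrightarrow>
    inv_into UNIV (p \<circ> q) = inv_into UNIV q \<circ> inv_into UNIV p"
  by (simp add: o_inv_distrib permutes_bij)

lemma image_inv_permutes:
  assumes "p permutes A" and "p ` X = Y"
  shows "inv_into UNIV p ` Y = X"
  using assms by (metis image_inv_f_f permutes_inj)

lemma horizontal_perms_comp:
  "p \<in> horizontal_perms t \<Longrightarrow> q \<in> horizontal_perms t \<Longrightarrow> p \<circ> q \<in> horizontal_perms t"
  unfolding horizontal_perms_def using sym_perms_comp[of p "tableau_size t" q]
  by (simp add: image_comp[symmetric, of p q] del: image_comp cong del: image_cong_simp)

lemma vertical_perms_comp:
  "p \<in> vertical_perms t \<Longrightarrow> q \<in> vertical_perms t \<Longrightarrow> p \<circ> q \<in> vertical_perms t"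
  unfolding vertical_perms_def using sym_perms_comp[of p "tableau_size t" q]
  by (simp add: image_comp[symmetric, of p q] del: image_comp cong del: image_cong_simp)

lemma inv_horizontal_perms:
  "p \<in> horizontal_perms t \<Longrightarrow> inv_into UNIV p \<in> horizontal_perms t"
  by (simp add: horizontal_perms_def sym_perms_def permutes_inv image_inv_permutes[of p "{1..tableau_size t}"])

lemma inv_vertical_perms:
  "p \<in> vertical_perms t \<Longrightarrow> inv_into UNIV p \<in> vertical_perms t"
  by (simp add: vertical_perms_def sym_perms_def permutes_inv image_inv_permutes[of p "{1..tableau_size t}"])

lemma horizontal_perms_permutes: "p \<in> horizontal_perms t \<Longrightarrow> p permutes {1..tableau_size t}"
  by (simp add: horizontal_perms_def sym_perms_def)

lemma vertical_perms_permutes: "p \<in> vertical_perms t \<Longrightarrow> p permutes {1..tableau_size t}"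
  by (simp add: vertical_perms_def sym_perms_def)

lemma finite_horizontal_perms: "finite (horizontal_perms t)"
  by (simp add: horizontal_perms_def)

text \<open>Left translation of the row group, in the form needed to reindex sums;
  \<open>bij_betw_comp_vertical\<close> is its counterpart for columns.\<close>

lemma bij_betw_comp_horizontal:
  assumes h: "h \<in> horizontal_perms t"
  shows "bij_betw (\<lambda>p. h \<circ> p) (horizontal_perms t) (horizontal_perms t)"
proof (rule bij_betw_byWitness[where f' = "\<lambda>p. inv_into UNIV h \<circ> p"])
  note * = permutes_inv_o[OF horizontal_perms_permutes[OF h]]
  show "\<forall>p\<in>horizontal_perms t. inv_into UNIV h \<circ> (h \<circ> p) = p"
    "\<forall>p\<in>horizontal_perms t. h \<circ> (inv_into UNIV h \<circ> p) = p"
    by (simp_all add: o_assoc *)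
qed (use h in \<open>auto intro: horizontal_perms_comp inv_horizontal_perms\<close>)

lemma bij_betw_comp_vertical:
  assumes h: "h \<in> vertical_perms t"
  shows "bij_betw (\<lambda>p. h \<circ> p) (vertical_perms t) (vertical_perms t)"
proof (rule bij_betw_byWitness[where f' = "\<lambda>p. inv_into UNIV h \<circ> p"])
  note * = permutes_inv_o[OF vertical_perms_permutes[OF h]]
  show "\<forall>p\<in>vertical_perms t. inv_into UNIV h \<circ> (h \<circ> p) = p"
    "\<forall>p\<in>vertical_perms t. h \<circ> (inv_into UNIV h \<circ> p) = p"
    by (simp_all add: o_assoc *)
qed (use h in \<open>auto intro: vertical_perms_comp inv_vertical_perms\<close>)

section \<open>The action of a starred Young symmetrizer\<close>

lemma act_star:
  "act r (star r a) T v = (\<Sum>p\<in>sym_perms r. a p * T (v \<circ> inv_into UNIV p))"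
proof -
  have "act r (star r a) T v =
      (\<Sum>s\<in>sym_perms r. \<Sum>p\<in>sym_perms r. if inv_into UNIV p = s then a p * T (v \<circ> s) else 0)"
    unfolding act_def star_def sum_distrib_right
    by (intro sum.cong refl) (simp add: comp_def)
  also have "\<dots> = (\<Sum>p\<in>sym_perms r. \<Sum>s\<in>sym_perms r.
      if inv_into UNIV p = s then a p * T (v \<circ> s) else 0)"
    by (rule sum.swap)
  also have "\<dots> = (\<Sum>p\<in>sym_perms r. a p * T (v \<circ> inv_into UNIV p))"
  proof (intro sum.cong refl)
    fix p assume "p \<in> sym_perms r"
    \<comment> \<open>Thus the only \<open>s\<close> that can contribute, the inverse of
      \<open>p\<close>, does occur in the range of summation.\<close>
    then have "inv_into UNIV p \<in> sym_perms r" by (simp add: sym_perms_def permutes_inv)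
    then show "(\<Sum>s\<in>sym_perms r. if inv_into UNIV p = s then a p * T (v \<circ> s) else 0) =
        a p * T (v \<circ> inv_into UNIV p)"
      by simp
  qed
  finally show ?thesis .
qed

text \<open>Inversion reverses \<open>p \<circ> q\<close>, so the row sum becomes the inner one.
  This separates the two symmetries: a row permutation affects only the inner sum, and the signs sit
  only in the outer one.\<close>

lemma act_star_young_symmetrizer:
  "act (tableau_size t) (star (tableau_size t) (young_symmetrizer t)) T v =
    (\<Sum>q\<in>vertical_perms t. of_int (sign q) *
      (\<Sum>p\<in>horizontal_perms t. T (v \<circ> inv_into UNIV q \<circ> inv_into UNIV p)))"
proof -
  let ?S = "sym_perms (tableau_size t)" and ?H = "horizontal_perms t" and ?V = "vertical_perms t"
  let ?f = "\<lambda>s p q. if p \<circ> q = s then of_int (sign q) * T (v \<circ> inv_into UNIV s) else 0"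
  have "act (tableau_size t) (star (tableau_size t) (young_symmetrizer t)) T v =
      (\<Sum>s\<in>?S. \<Sum>p\<in>?H. \<Sum>q\<in>?V. ?f s p q)"
    unfolding act_star young_symmetrizer_def sum_distrib_right
    by (intro sum.cong refl) simp
  also have "\<dots> = (\<Sum>p\<in>?H. \<Sum>q\<in>?V. \<Sum>s\<in>?S. ?f s p q)"
    by (rule trans[OF sum.swap], rule sum.cong[OF refl], rule sum.swap)
  also have "\<dots> = (\<Sum>p\<in>?H. \<Sum>q\<in>?V. of_int (sign q) *
      T (v \<circ> inv_into UNIV q \<circ> inv_into UNIV p))"
  proof (intro sum.cong refl)
    fix p q assume "p \<in> ?H" "q \<in> ?V"
    then have pq: "p \<circ> q \<in> ?S"
      by (simp add: horizontal_perms_def vertical_perms_def sym_perms_comp)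
    have "inv_into UNIV (p \<circ> q) = inv_into UNIV q \<circ> inv_into UNIV p"
      using \<open>p \<in> ?H\<close> \<open>q \<in> ?V\<close>
      by (blast intro: inv_into_comp_permutes horizontal_perms_permutes vertical_perms_permutes)
    with pq show "(\<Sum>s\<in>?S. ?f s p q) =
        of_int (sign q) * T (v \<circ> inv_into UNIV q \<circ> inv_into UNIV p)"
      by (simp add: o_assoc)
  qed
  also have "\<dots> = (\<Sum>q\<in>?V. of_int (sign q) *
      (\<Sum>p\<in>?H. T (v \<circ> inv_into UNIV q \<circ> inv_into UNIV p)))"
    unfolding sum_distrib_left by (rule sum.swap)
  finally show ?thesis .
qed

text \<open>Composing the inverse of \<open>p\<close> with \<open>h\<close> gives the inverse of
  \<open>inv_into UNIV h \<circ> p\<close>, and left translation permutes the row group. Hence each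
  inner sum is already invariant, before any alternation over columns.\<close>

lemma act_star_young_symmetrizer_row:
  assumes h: "h \<in> horizontal_perms t"
  shows "act (tableau_size t) (star (tableau_size t) (young_symmetrizer t)) (\<lambda>u. T (u \<circ> h)) =
    act (tableau_size t) (star (tableau_size t) (young_symmetrizer t)) T"
proof
  fix v
  let ?H = "horizontal_perms t"
  have "(\<Sum>p\<in>?H. T (u \<circ> inv_into UNIV p \<circ> h)) = (\<Sum>p\<in>?H. T (u \<circ> inv_into UNIV p))" for u
  proof -
    have "(\<Sum>p\<in>?H. T (u \<circ> inv_into UNIV p)) = (\<Sum>p\<in>?H. T (u \<circ> inv_into UNIV (inv_into UNIV h \<circ> p)))"
      by (rule sum.reindex_bij_betw[symmetric])
        (intro bij_betw_comp_horizontal inv_horizontal_perms h)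
    also have "\<dots> = (\<Sum>p\<in>?H. T (u \<circ> inv_into UNIV p \<circ> h))"
    proof (intro sum.cong refl)
      fix p assume "p \<in> ?H"
      then have "inv_into UNIV (inv_into UNIV h \<circ> p) = inv_into UNIV p \<circ> h"
        using h by (metis horizontal_perms_permutes inv_into_comp_permutes permutes_inv permutes_inv_inv)
      then show "T (u \<circ> inv_into UNIV (inv_into UNIV h \<circ> p)) = T (u \<circ> inv_into UNIV p \<circ> h)"
        by (simp add: o_assoc)
    qed
    finally show ?thesis by simp
  qed
  then show "act (tableau_size t) (star (tableau_size t) (young_symmetrizer t)) (\<lambda>u. T (u \<circ> h)) v =
      act (tableau_size t) (star (tableau_size t) (young_symmetrizer t)) T v"
    by (simp add: act_star_young_symmetrizer)
qed

text \<open>To reach the outer sum, \<open>g\<close> has to pass through the row sum. As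
  \<open>g\<close> maps rows to rows, it normalizes the row group, so this passage is a reindexing
  by conjugation. The alternating sum then absorbs \<open>g\<close> by a translation and leaves
  \<open>sign g\<close>.\<close>

lemma act_star_young_symmetrizer_column:
  assumes g: "g \<in> vertical_perms t"
    and rows: "\<And>row. row \<in> set t \<Longrightarrow> \<exists>row'\<in>set t. g ` set row = set row'"
  shows "act (tableau_size t) (star (tableau_size t) (young_symmetrizer t)) (\<lambda>u. T (u \<circ> g)) v =
    of_int (sign g) * act (tableau_size t) (star (tableau_size t) (young_symmetrizer t)) T v"
proof -
  let ?H = "horizontal_perms t" and ?V = "vertical_perms t"
  let ?inv = "\<lambda>p :: nat \<Rightarrow> nat. inv_into UNIV p"
  let ?c = "\<lambda>p. ?inv g \<circ> p \<circ> g"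
  let ?F = "\<lambda>u. \<Sum>p\<in>?H. T (u \<circ> ?inv p)"
  have gp: "g permutes {1..tableau_size t}" by (rule vertical_perms_permutes[OF g])
  note g_inv = permutes_inv_o[OF gp]
  \<comment> \<open>\<open>g\<close> carries a row to another row, \<open>p\<close> stabilizes that
    row, and the inverse of \<open>g\<close> carries it back.\<close>
  have conj_in: "?c p \<in> ?H" if p: "p \<in> ?H" for p
  proof -
    have "?c p ` set row = set row" if "row \<in> set t" for row
    proof -
      obtain row' where "row' \<in> set t" "g ` set row = set row'" using rows \<open>row \<in> set t\<close> by blast
      moreover from this have "p ` set row' = set row'" using p by (simp add: horizontal_perms_def)
      ultimately show ?thesis
        by (simp add: image_comp[symmetric] image_inv_permutes[OF gp] del: image_comp cong del: image_cong_simp)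
    qed
    then show ?thesis
      using p gp by (simp add: horizontal_perms_def sym_perms_def permutes_compose permutes_inv)
  qed
  have "inj_on ?c ?H"
  proof (rule inj_onI)
    fix p p' assume "?c p = ?c p'"
    then have "g \<circ> ?c p \<circ> ?inv g = g \<circ> ?c p' \<circ> ?inv g" by simp
    then show "p = p'" by (simp add: o_assoc g_inv) (simp add: o_assoc[symmetric] g_inv)
  qed
  then have bij: "bij_betw ?c ?H ?H"
    using conj_in by (simp add: bij_betw_def endo_inj_surj finite_horizontal_perms image_subsetI)
  have F: "(\<Sum>p\<in>?H. T (u \<circ> ?inv p \<circ> g)) = ?F (u \<circ> g)" for u
  proof -
    have "?F (u \<circ> g) = (\<Sum>p\<in>?H. T (u \<circ> g \<circ> ?inv (?c p)))"
      by (rule sum.reindex_bij_betw[OF bij, symmetric])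
    also have "\<dots> = (\<Sum>p\<in>?H. T (u \<circ> ?inv p \<circ> g))"
    proof (intro sum.cong refl)
      fix p assume "p \<in> ?H"
      note pp = horizontal_perms_permutes[OF this]
      \<comment> \<open>Inverting the conjugate inverts only \<open>p\<close>; the leading inverse
        of \<open>g\<close> then cancels against the \<open>g\<close> already applied to
        \<open>u\<close>.\<close>
      have "?inv (?c p) = ?inv g \<circ> (?inv p \<circ> g)"
        using inv_into_comp_permutes[OF permutes_compose[OF pp permutes_inv[OF gp]] gp]
          inv_into_comp_permutes[OF permutes_inv[OF gp] pp] permutes_inv_inv[OF gp]
        by simp
      then have "g \<circ> ?inv (?c p) = ?inv p \<circ> g" by (simp add: o_assoc g_inv)
      then show "T (u \<circ> g \<circ> ?inv (?c p)) = T (u \<circ> ?inv p \<circ> g)" by (metis o_assoc)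
    qed
    finally show ?thesis by simp
  qed
  have "act (tableau_size t) (star (tableau_size t) (young_symmetrizer t)) (\<lambda>u. T (u \<circ> g)) v =
      (\<Sum>q\<in>?V. of_int (sign q) * ?F (v \<circ> ?inv q \<circ> g))"
    by (simp add: act_star_young_symmetrizer F)
  \<comment> \<open>After the substitution of \<open>g \<circ> q\<close> for \<open>q\<close>, the
    inverse of \<open>g\<close> meets the trailing \<open>g\<close> and both vanish from the
    argument.\<close>
  also have "\<dots> = (\<Sum>q\<in>?V. of_int (sign (g \<circ> q)) * ?F (v \<circ> ?inv (g \<circ> q) \<circ> g))"
    by (rule sum.reindex_bij_betw[OF bij_betw_comp_vertical[OF g], symmetric])
  also have "\<dots> = (\<Sum>q\<in>?V. of_int (sign g) * (of_int (sign q) * ?F (v \<circ> ?inv q)))"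
  proof (intro sum.cong refl)
    fix q assume "q \<in> ?V"
    note qp = vertical_perms_permutes[OF this]
    have "sign (g \<circ> q) = sign g * sign q"
      using gp qp by (intro sign_compose) (auto simp: permutation_permutes)
    moreover have "v \<circ> ?inv (g \<circ> q) \<circ> g = v \<circ> ?inv q"
    proof -
      have "?inv (g \<circ> q) \<circ> g = ?inv q \<circ> (?inv g \<circ> g)"
        by (simp add: inv_into_comp_permutes[OF gp qp] o_assoc)
      then show ?thesis by (simp add: g_inv o_assoc[symmetric])
    qed
    ultimately show "of_int (sign (g \<circ> q)) * ?F (v \<circ> ?inv (g \<circ> q) \<circ> g) =
        of_int (sign g) * (of_int (sign q) * ?F (v \<circ> ?inv q))"
      by (simp add: mult.assoc)
  qed
  finally show ?thesis by (simp add: act_star_young_symmetrizer sum_distrib_left)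
qed

lemma act_uminus: "act r a (\<lambda>u. - T u) = (\<lambda>v. - act r a T v)"
  by (simp add: act_def sum_negf)

lemma covariant_tensors_cong:
  "T \<in> covariant_tensors scl r \<Longrightarrow> (\<And>i. i \<in> {1..r} \<Longrightarrow> v i = v' i) \<Longrightarrow> T v = T v'"
  by (simp add: covariant_tensors_def)

text \<open>Locality passes from \<open>T\<close> to \<open>U\<close> because every \<open>p\<close>
  in the group maps \<open>{1..r}\<close> to itself. It allows argument tuples to be compared in
  their first \<open>r\<close> entries only.\<close>

lemma symmetry_class_cong:
  assumes "U \<in> symmetry_class scl r J" and "\<And>i. i \<in> {1..r} \<Longrightarrow> v i = v' i"
  shows "U v = U v'"
proof -
  obtain a T where U: "U = act r a T" and T: "T \<in> covariant_tensors scl r"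
    using assms(1) by (auto simp: symmetry_class_def)
  have "T (\<lambda>i. v (p i)) = T (\<lambda>i. v' (p i))" if "p \<in> sym_perms r" for p
    using assms(2) permutes_in_image[of p "{1..r}"] that
    unfolding sym_perms_def by (intro covariant_tensors_cong[OF T]) blast
  then show ?thesis by (simp add: U act_def)
qed

text \<open>Columns are indexed from 0, and \<open>vertical_perms\<close> quantifies over all
  \<open>j\<close>; beyond the tableau the column is empty and imposes no condition.\<close>

lemma tableau_column_rectangle:
  "tableau_column [[1, 3], [2, 4]] j = (if j = 0 then {1, 2} else if j = 1 then {3, 4} else {})"
  proof -
  have "tableau_column [[1, 3], [2, 4]] j =
      {row ! j | row. row = [1, 3] \<and> j < 2} \<union> {row ! j | row. row = [2, 4] \<and> j < 2}"
    unfolding tableau_column_def by fastforce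
  then show ?thesis by (auto simp: less_Suc_eq numeral_2_eq_2)
qed

lemma permutes_transpose_comp:
  "a \<in> X \<Longrightarrow> b \<in> X \<Longrightarrow> p permutes X \<Longrightarrow> Transposition.transpose a b \<circ> p permutes X"
  by (simp add: permutes_compose permutes_swap_id)

theorem lemma1p6:
  fixes scl :: "'k::{real_normed_field, euclidean_space} \<Rightarrow> 'v::ab_group_add \<Rightarrow> 'v"
    and B :: "'v set"
    and \<rr> :: "((nat \<Rightarrow> nat) \<Rightarrow> 'k) set"
    and U S A w :: "(nat \<Rightarrow> 'v) \<Rightarrow> 'k"
  assumes "finite_dimensional_vector_space scl B"
    and "minimal_right_ideal \<rr> (group_ring 3)"
    and "belongs_to_partition \<rr> [2, 1]"
    and "U \<in> symmetry_class scl 3 \<rr>"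
    and "S \<in> symmetric_2_forms scl"
    and "A \<in> alternating_2_forms scl"
    and "w \<in> covariant_tensors scl 1"
  shows "act 4 (star 4 (young_symmetrizer [[1, 3], [2, 4]])) (tensor_product 3 U w)
           = act 4 (star 4 (young_symmetrizer [[1, 3], [2, 4]])) (tensor_product 1 w U)
     \<and> act 5 (star 5 (young_symmetrizer [[1, 3, 5], [2, 4]])) (tensor_product 3 U S)
           = act 5 (star 5 (young_symmetrizer [[1, 3, 5], [2, 4]])) (tensor_product 2 S U)
     \<and> act 5 (star 5 (young_symmetrizer [[1, 3, 5], [2, 4]])) (tensor_product 3 U A)
           = (\<lambda>v. - act 5 (star 5 (young_symmetrizer [[1, 3, 5], [2, 4]])) (tensor_product 2 A U) v)"
proof -
  let ?t = "[[1, 3], [2, 4]] :: nat list list" and ?t' = "[[1, 3, 5], [2, 4]] :: nat list list"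
  let ?y = "\<lambda>T :: (nat \<Rightarrow> 'v) \<Rightarrow> 'k. act 4 (star 4 (young_symmetrizer ?t)) T"
  let ?y' = "\<lambda>T :: (nat \<Rightarrow> 'v) \<Rightarrow> 'k. act 5 (star 5 (young_symmetrizer ?t')) T"
  note U_cong = symmetry_class_cong[OF \<open>U \<in> symmetry_class scl 3 \<rr>\<close>]
  have set3: "i \<in> {1..3} \<longleftrightarrow> i = 1 \<or> i = 2 \<or> i = 3"
    and set2: "i \<in> {1..2} \<longleftrightarrow> i = 1 \<or> i = 2" for i :: nat
    by auto
  \<comment> \<open>The simplifier rewrites the entry \<open>1\<close> to \<open>Suc 0\<close>, so
    the rules are stored in that form in order to match.\<close>
  have size [unfolded One_nat_def, simp]: "tableau_size ?t = 4" "tableau_size ?t' = 5"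
    by (simp_all add: tableau_size_def)

  \<comment> \<open>The tuple \<open>u \<circ> g \<circ> h\<close> begins with u4, u1, u2, u3:
    \<open>w\<close> receives u4, and \<open>U\<close> receives u1, u2, u3. This 4-cycle does not
    preserve the rows and is therefore split into a row permutation \<open>h\<close> and a column
    permutation \<open>g\<close> that swaps the two rows.\<close>
  define h where "h = Transposition.transpose 1 (3::nat)"
  define g where "g = Transposition.transpose 1 2 \<circ> Transposition.transpose 3 (4::nat)"
  have h_vals: "h 1 = 3" "h 2 = 2" "h 3 = 1" "h 4 = 4"
    by (simp_all add: h_def Transposition.transpose_def)
  have g_vals: "g 1 = 2" "g 2 = 1" "g 3 = 4" "g 4 = 3"
    by (simp_all add: g_def Transposition.transpose_def)
  have "h permutes {1..4}" unfolding h_def by (rule permutes_swap_id) auto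
  then have h: "h \<in> horizontal_perms ?t"
    using h_vals by (auto simp: horizontal_perms_def sym_perms_def)
  have "g permutes {1..4}"
    unfolding g_def by (intro permutes_transpose_comp permutes_swap_id) auto
  then have g: "g \<in> vertical_perms ?t"
    using g_vals by (auto simp: vertical_perms_def sym_perms_def tableau_column_rectangle[unfolded One_nat_def])
  have "permutation (Transposition.transpose 1 (2::nat))" "permutation (Transposition.transpose 3 (4::nat))"
    by (rule permutation_swap_id)+
  then have sign_g: "sign g = 1" by (simp add: g_def sign_compose sign_swap_id)
  have Uw: "tensor_product 3 U w = (\<lambda>u. tensor_product 1 w U ((u \<circ> g) \<circ> h))"
  proof
    fix u :: "nat \<Rightarrow> 'v"
    have "U (\<lambda>i. (u \<circ> g \<circ> h) (1 + i)) = U u"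
      using h_vals g_vals by (intro U_cong) (unfold set3, auto simp: numeral_2_eq_2[symmetric])
    moreover have "w (u \<circ> g \<circ> h) = w (\<lambda>i. u (3 + i))"
      using h_vals g_vals by (intro covariant_tensors_cong[OF assms(7)]) auto
    ultimately show "tensor_product 3 U w u = tensor_product 1 w U ((u \<circ> g) \<circ> h)"
      by (simp add: tensor_product_def)
  qed
  have rows: "\<exists>row'\<in>set ?t. g ` set row = set row'" if "row \<in> set ?t" for row
    using that g_vals by auto
  have "?y (tensor_product 3 U w) = ?y (\<lambda>u. tensor_product 1 w U (u \<circ> h))"
    \<comment> \<open>The factor \<open>g\<close> acts on \<open>u\<close> first, so it is removed
      first, with \<open>h\<close> still inside the tensor.\<close>
    using act_star_young_symmetrizer_column[OF g rows, of "\<lambda>u. tensor_product 1 w U (u \<circ> h)"]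
    by (simp add: Uw sign_g fun_eq_iff)
  also have "\<dots> = ?y (tensor_product 1 w U)"
    using act_star_young_symmetrizer_row[OF h, of "tensor_product 1 w U"] by simp
  finally have first: "?y (tensor_product 3 U w) = ?y (tensor_product 1 w U)" .

  \<comment> \<open>The tuple \<open>u \<circ> k\<close> is u5, u4, u1, u2, u3. The order u4, u5 in
    front would send 1 to 4 and leave the first row, whereas u5, u4 keeps every index in its
    row.\<close>
  define k where "k = Transposition.transpose 2 4 \<circ>
    (Transposition.transpose 1 3 \<circ> Transposition.transpose 1 (5::nat))"
  have k_vals: "k 1 = 5" "k 2 = 4" "k 3 = 1" "k 4 = 2" "k 5 = 3"
    by (simp_all add: k_def Transposition.transpose_def)
  have "k permutes {1..5}"
    unfolding k_def by (intro permutes_transpose_comp permutes_swap_id) auto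
  then have k: "k \<in> horizontal_perms ?t'"
    using k_vals by (auto simp: horizontal_perms_def sym_perms_def)
  have row': "?y' (\<lambda>u. T (u \<circ> k)) = ?y' T" for T
    using act_star_young_symmetrizer_row[OF k, of T] by simp
  \<comment> \<open>Stated for an arbitrary 2-tensor \<open>Q\<close>, so that the symmetric and the
    alternating case differ only in how the exchanged arguments are restored.\<close>
  have exchange: "tensor_product 2 Q U (u \<circ> k) =
      Q ((\<lambda>i. u (3 + i)) \<circ> Transposition.transpose 1 2) * U u"
    if Q: "Q \<in> covariant_tensors scl 2" for Q u
  proof -
    have "U (\<lambda>i. (u \<circ> k) (2 + i)) = U u"
      using k_vals by (intro U_cong) (unfold set3, auto simp: numeral_2_eq_2[symmetric])
    moreover have "Q (u \<circ> k) = Q ((\<lambda>i. u (3 + i)) \<circ> Transposition.transpose 1 2)"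
      using k_vals
      by (intro covariant_tensors_cong[OF Q]) (unfold set2, auto simp: Transposition.transpose_def)
    ultimately show ?thesis by (simp add: tensor_product_def)
  qed
  have "tensor_product 3 U S = (\<lambda>u. tensor_product 2 S U (u \<circ> k))"
    using assms(5) exchange[of S]
    by (auto simp: symmetric_2_forms_def tensor_product_def)
  then have second: "?y' (tensor_product 3 U S) = ?y' (tensor_product 2 S U)"
    by (simp only: row')
  \<comment> \<open>Restoring the order of the arguments of \<open>A\<close> produces the minus
    sign, which \<open>act_uminus\<close> then moves outside the action.\<close>
  have "tensor_product 3 U A = (\<lambda>u. - tensor_product 2 A U (u \<circ> k))"
    using assms(6) exchange[of A]
    by (auto simp: alternating_2_forms_def tensor_product_def)
  then have third: "?y' (tensor_product 3 U A) = (\<lambda>v. - ?y' (tensor_product 2 A U) v)"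
    by (simp only: act_uminus row')
  from first second third show ?thesis by blast
qed

end
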